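(* Let $(m,i,j)$ be one of the digit-rule data $(3,1,-1)$, $(2,1,0)$, $(2,0,1)$ attached to the billiard tables, and let $d=(d_0,d_1,d_2,\dots)\in\{0,1,\dots,m-1\}^{\infty}$ be a periodic digit string. The following are equivalent. (1) $d$ is a periodic nonsingular billiard sequence, that is, $d=\tau_s$ is the digit string of some nonsingular ray $\tau$ with a rational direction $v_0=n^{-1}(qv_1+(n-q)v_2)$, where $0<q<n$ are coprime integers. (2) There exist coprime integers $0<q<n$ such that the digits of $d$ are constructed from the ordered list $\mathcal{C}_{q,n}$ of $q$-cycles of $n$ according to the "$+i$ within, $+j$ between" rule.
   Context: Tables and labels. The billiard table $\Delta$ is one of the convex polygons that tile $\mathbb{R}^2$ under reflection. Unfolding a billiard trajectory across the edges of $\Delta$ turns it into a ray $\tau$ in the edge-labelled tessellation $\Lambda$ of $\mathbb{R}^2$ by reflected copies of $\Delta$, and the sequence of labels of successive bounces is the sequence of labels of the edges met by $\tau$. After deletion of certain families of edges, the remaining labelled edges form the following general scheme. There are linearly independent vectors $v_1,v_2\in\mathbb{R}^2$ generating the vertex lattice, and the remaining labels are digits modulo $m$. Moving from one edge to the next by a unit step in $v_1$ adds $j$ to the digit modulo $m$, and moving by a unit step in $v_2$ adds $i$ to the digit modulo $m$. The data are: equilateral triangle ($A_2$): $m=3$, $i=1$, $j=-1$; $45$-$45$-$90$ triangle ($B_2$): $m=2$, $i=1$, $j=0$; square ($D_2$): $m=2$, $i=0$, $j=1$; the $30$-$60$-$90$ triangle ($G_2$) is reduced to the $D_2$ data by a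 linear map. Digit string of a ray. A ray is $\tau=\{p_0+tv_0: t\ge 0\}$ with $v_0=n^{-1}(qv_1+(n-q)v_2)$ and $p_0=av_1+(1-a)v_2$, where by convention $a>0$ is negligibly small, meaning $0<a<1/n$, so that $\tau$ starts on an edge with digit $0$. It is nonsingular if it passes through no vertex of the lattice $\mathbb{Z}v_1+\mathbb{Z}v_2$. The point $p_0+kv_0$ lies on the edge joining $X_kv_1+(k+1-X_k)v_2$ to $(X_k+1)v_1+(k-X_k)v_2$, where $X_k=\lfloor a+kq/n\rfloor$. The digit string $\tau_s=(d_0,d_1,\dots)$ consists of the labels of the edges at $p_0,p_0+v_0,p_0+2v_0,\dots$, so that $d_k\equiv jX_k+i(k-X_k) \pmod m$. $q$-cycles. Let $0<q<n$ be coprime. For an integer $0\le a<q$ let $k$ be the largest integer with $a+kq<n$. The $q$-cycle of $a$ in $n$ is the arithmetic progression $C_a=(a,a+q,\dots,a+kq)$, with minimal element $a$ and maximal element $a+kq$. The $q$-cycles partition $\{0,1,\dots,n-1\}$. The ordered list $\mathcal{C}_{q,n}$ is the list of all $q$-cycles starting with $C_0$, in which a cycle with maximal element $M$ is followed by the cycle with minimal element $M+q-n$. Its concatenation is $e_0,e_1,\dots,e_{n-1}$ with $e_k=kq \bmod n$, and the list is repeated periodically. "$+i$ within, $+j$ between" rule. The string $d$ constructed from $\mathcal{C}_{q,n}$ has $d_0=0$ and, for $k\ge1$, with $e_k=kq \bmod n$: $d_k\equiv d_{k-1}+i \pmod m$ if $e_k$ follows $e_{k-1}$ within a $q$-cycle,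 and $d_k\equiv d_{k-1}+j\pmod m$ if $e_k$ is the minimal element of the next $q$-cycle in the (periodically repeated) list. *)

theory Defs
  imports "HOL-Analysis.Analysis" "HOL-Number_Theory.Cong"
begin

text \<open>The digit-rule data \<open>(m, i, j)\<close> of the equilateral triangle, the 45-45-90 triangle and the
  square, in this order; the 30-60-90 triangle is reduced to the data of the square.\<close>

definition digit_rule_data :: "(int \<times> int \<times> int) set" where
  "digit_rule_data = {(3, 1, -1), (2, 1, 0), (2, 0, 1)}"


section \<open>Rays and their digit strings\<close>

definition vertex_lattice :: "real ^ 2 \<Rightarrow> real ^ 2 \<Rightarrow> (real ^ 2) set" where
  "vertex_lattice v1 v2 = {of_int x *\<^sub>R v1 + of_int y *\<^sub>R v2 | x y :: int. True}"

text \<open>The labelled edges that remain after deletion are the translates by \<open>x v\<^sub>1 + y v\<^sub>2\<close> of the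
  edge that joins \<open>v\<^sub>2\<close> to \<open>v\<^sub>1\<close>.  They all lie on the lines on which the two coordinates with
  respect to \<open>v\<^sub>1, v\<^sub>2\<close> have an integer sum, so a ray as below meets them exactly at the
  times \<open>t = 0, 1, 2, \<dots>\<close>.\<close>

definition lattice_edge :: "real ^ 2 \<Rightarrow> real ^ 2 \<Rightarrow> int \<Rightarrow> int \<Rightarrow> (real ^ 2) set" where
  "lattice_edge v1 v2 x y =
     closed_segment (of_int x *\<^sub>R v1 + of_int (y + 1) *\<^sub>R v2) (of_int (x + 1) *\<^sub>R v1 + of_int y *\<^sub>R v2)"

definition edge_label :: "int \<Rightarrow> int \<Rightarrow> int \<Rightarrow> int \<Rightarrow> int \<Rightarrow> int" where
  "edge_label m i j x y = (j * x + i * y) mod m"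

text \<open>The formula is the one forced by label \<open>0\<close> on the initial edge and the two step rules.\<close>

lemma edge_label_initial: "edge_label m i j 0 0 = 0"
  by (simp add: edge_label_def)

lemma edge_label_step_v1: "[edge_label m i j (x + 1) y = edge_label m i j x y + j] (mod m)"
  by (simp add: edge_label_def cong_def algebra_simps mod_simps)

lemma edge_label_step_v2: "[edge_label m i j x (y + 1) = edge_label m i j x y + i] (mod m)"
  by (simp add: edge_label_def cong_def algebra_simps mod_simps)

definition ray_start :: "real ^ 2 \<Rightarrow> real ^ 2 \<Rightarrow> real \<Rightarrow> real ^ 2" where
  "ray_start v1 v2 a = a *\<^sub>R v1 + (1 - a) *\<^sub>R v2"

definition ray_direction :: "real ^ 2 \<Rightarrow> real ^ 2 \<Rightarrow> nat \<Rightarrow> nat \<Rightarrow> real ^ 2" where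
  "ray_direction v1 v2 q n = (1 / real n) *\<^sub>R (real q *\<^sub>R v1 + (real n - real q) *\<^sub>R v2)"

definition ray :: "real ^ 2 \<Rightarrow> real ^ 2 \<Rightarrow> (real ^ 2) set" where
  "ray p v = {p + t *\<^sub>R v | t :: real. 0 \<le> t}"

definition nonsingular :: "real ^ 2 \<Rightarrow> real ^ 2 \<Rightarrow> (real ^ 2) set \<Rightarrow> bool" where
  "nonsingular v1 v2 \<tau> \<longleftrightarrow> \<tau> \<inter> vertex_lattice v1 v2 = {}"

text \<open>On a nonsingular ray each point \<open>p + k v\<close> lies on exactly one edge, so that the relation below
  determines \<open>d\<close>.\<close>

definition is_digit_string ::
    "real ^ 2 \<Rightarrow> real ^ 2 \<Rightarrow> int \<Rightarrow> int \<Rightarrow> int \<Rightarrow> real ^ 2 \<Rightarrow> real ^ 2 \<Rightarrow> (nat \<Rightarrow> int) \<Rightarrow> bool" where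
  "is_digit_string v1 v2 m i j p v d \<longleftrightarrow>
     (\<forall>k. \<exists>x y. p + real k *\<^sub>R v \<in> lattice_edge v1 v2 x y \<and> d k = edge_label m i j x y)"

definition nonsingular_billiard_sequence ::
    "real ^ 2 \<Rightarrow> real ^ 2 \<Rightarrow> int \<Rightarrow> int \<Rightarrow> int \<Rightarrow> (nat \<Rightarrow> int) \<Rightarrow> bool" where
  "nonsingular_billiard_sequence v1 v2 m i j d \<longleftrightarrow>
     (\<exists>(q::nat) (n::nat) (a::real). 0 < q \<and> q < n \<and> coprime q n \<and> 0 < a \<and> a < 1 / real n \<and>
        nonsingular v1 v2 (ray (ray_start v1 v2 a) (ray_direction v1 v2 q n)) \<and>
        is_digit_string v1 v2 m i j (ray_start v1 v2 a) (ray_direction v1 v2 q n) d)"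


section \<open>\<open>q\<close>-cycles\<close>

definition q_cycle :: "nat \<Rightarrow> nat \<Rightarrow> nat \<Rightarrow> nat list" where
  "q_cycle q n a = map (\<lambda>l. a + l * q) [0..<Suc (GREATEST k. a + k * q < n)]"

text \<open>The minimal element of the \<open>t\<close>-th cycle in the ordered list.  The subtraction does not
  truncate, since the maximal element \<open>M\<close> of a cycle satisfies \<open>M + q \<ge> n\<close>.\<close>

primrec q_cycle_min :: "nat \<Rightarrow> nat \<Rightarrow> nat \<Rightarrow> nat" where
  "q_cycle_min q n 0 = 0"
| "q_cycle_min q n (Suc t) = last (q_cycle q n (q_cycle_min q n t)) + q - n"

text \<open>There are \<open>q\<close> cycles, one for each minimal element \<open>0 \<le> a < q\<close>.\<close>

definition q_cycle_list :: "nat \<Rightarrow> nat \<Rightarrow> nat list list" where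
  "q_cycle_list q n = map (\<lambda>t. q_cycle q n (q_cycle_min q n t)) [0..<q]"

definition q_cycle_entry :: "nat \<Rightarrow> nat \<Rightarrow> nat \<Rightarrow> nat" where
  "q_cycle_entry q n k =
     (let es = concat (q_cycle_list q n) in es ! (k mod length es))"

definition follows_within_q_cycle :: "nat \<Rightarrow> nat \<Rightarrow> nat \<Rightarrow> nat \<Rightarrow> bool" where
  "follows_within_q_cycle q n e e' \<longleftrightarrow>
     (\<exists>C \<in> set (q_cycle_list q n). \<exists>l. Suc l < length C \<and> C ! l = e \<and> C ! Suc l = e')"

text \<open>The index modulo \<open>q\<close> accounts for the periodic repetition of the list.\<close>

definition starts_next_q_cycle :: "nat \<Rightarrow> nat \<Rightarrow> nat \<Rightarrow> nat \<Rightarrow> bool" where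
  "starts_next_q_cycle q n e e' \<longleftrightarrow>
     (\<exists>t < q. e = last (q_cycle_list q n ! t) \<and> e' = hd (q_cycle_list q n ! (Suc t mod q)))"

definition constructed_from_q_cycles ::
    "int \<Rightarrow> int \<Rightarrow> int \<Rightarrow> nat \<Rightarrow> nat \<Rightarrow> (nat \<Rightarrow> int) \<Rightarrow> bool" where
  "constructed_from_q_cycles m i j q n d \<longleftrightarrow>
     d 0 = 0 \<and>
     (\<forall>k. (follows_within_q_cycle q n (q_cycle_entry q n k) (q_cycle_entry q n (Suc k))
             \<longrightarrow> [d (Suc k) = d k + i] (mod m)) \<and>
          (starts_next_q_cycle q n (q_cycle_entry q n k) (q_cycle_entry q n (Suc k))
             \<longrightarrow> [d (Suc k) = d k + j] (mod m)))"

end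

theory Submission imports Defs begin

text \<open>Both conditions describe the sequence \<open>(j X\<^sub>k + i (k - X\<^sub>k)) mod m\<close> with
  \<open>X\<^sub>k = \<lfloor>kq/n\<rfloor>\<close>, for the same \<open>q\<close> and \<open>n\<close>.

  For the ray, use coordinates with respect to the basis \<open>v\<^sub>1, v\<^sub>2\<close>.  The point at time \<open>t\<close> has
  coordinate sum \<open>1 + t\<close>, and at an integer time \<open>k\<close> its first coordinate is \<open>a + kq/n\<close>.  Since
  \<open>0 < a < 1/n\<close>, this number is never an integer and has integer part \<open>X\<^sub>k\<close>.  Hence every such ray
  misses the vertices, and its \<open>k\<close>-th bounce is on the edge at \<open>(X\<^sub>k, k - X\<^sub>k)\<close> and on no other
  (\<open>ray_point_on_lattice_edge_iff\<close>).

  For the \<open>q\<close>-cycles, the concatenated list is \<open>kq mod n\<close> for \<open>k < n\<close>, because inside a cycle one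
  adds \<open>q\<close>, and passing from one cycle to the next adds \<open>q - n\<close>
  (\<open>q_cycle_entry_eq\<close>).  A step from \<open>e = kq mod n\<close> is a step between cycles exactly if
  \<open>e + q \<ge> n\<close>, which is exactly the carry that makes \<open>X\<close> grow by one; otherwise \<open>k - X\<^sub>k\<close> grows by
  one.  So the rule adding \<open>i\<close> within and \<open>j\<close> between cycles produces the formula above by
  summation.\<close>

section \<open>The ordered list of \<open>q\<close>-cycles\<close>

lemma less_length_q_cycle_iff:
  assumes "0 < q" "a < n"
  shows "l < length (q_cycle q n a) \<longleftrightarrow> a + l * q < n"
proof -
  let ?P = "\<lambda>k. a + k * q < n"
  have bound: "\<forall>k. ?P k \<longrightarrow> k \<le> n"
  proof (intro allI impI)
    fix k assume "?P k"
    moreover have "k \<le> k * q" using assms by simp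
    ultimately show "k \<le> n" by linarith
  qed
  have greatest: "?P (Greatest ?P)"
    by (rule GreatestI_nat[of ?P 0 n]) (use assms bound in auto)
  have "l \<le> Greatest ?P \<longleftrightarrow> ?P l"
  proof
    assume "l \<le> Greatest ?P"
    then have "l * q \<le> Greatest ?P * q" by simp
    with greatest show "?P l" by linarith
  next
    assume "?P l"
    then show "l \<le> Greatest ?P" using bound by (blast intro: Greatest_le_nat)
  qed
  then show ?thesis by (simp add: q_cycle_def less_Suc_eq_le)
qed

lemma nth_q_cycle: "l < length (q_cycle q n a) \<Longrightarrow> q_cycle q n a ! l = a + l * q"
  by (simp add: q_cycle_def del: upt_Suc)

lemma q_cycle_not_Nil: "q_cycle q n a \<noteq> []"
  by (simp add: q_cycle_def)

lemma hd_q_cycle: "hd (q_cycle q n a) = a"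
  using nth_q_cycle[of 0 q n a] q_cycle_not_Nil[of q n a] by (simp add: hd_conv_nth)

lemma last_q_cycle: "last (q_cycle q n a) = a + (length (q_cycle q n a) - 1) * q"
  using nth_q_cycle[of "length (q_cycle q n a) - 1" q n a] q_cycle_not_Nil[of q n a]
  by (simp add: last_conv_nth)

lemma last_q_cycle_add:
  assumes "0 < q" "a < n"
  shows "last (q_cycle q n a) < n"
    and "last (q_cycle q n a) + q = a + length (q_cycle q n a) * q"
    and "n \<le> last (q_cycle q n a) + q"
proof -
  obtain L where L: "length (q_cycle q n a) = Suc L"
    using q_cycle_not_Nil[of q n a] by (cases "length (q_cycle q n a)") auto
  show "last (q_cycle q n a) < n"
    using less_length_q_cycle_iff[OF assms, of L] by (simp add: last_q_cycle L)
  show sum: "last (q_cycle q n a) + q = a + length (q_cycle q n a) * q"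
    by (simp add: last_q_cycle L)
  show "n \<le> last (q_cycle q n a) + q"
    using less_length_q_cycle_iff[OF assms, of "length (q_cycle q n a)"] sum by simp
qed

lemma q_cycle_min_less:
  assumes "0 < q" "q < n"
  shows "q_cycle_min q n t < q"
proof (induction t)
  case 0
  then show ?case using assms by simp
next
  case (Suc t)
  then have "q_cycle_min q n t < n" using assms by simp
  from last_q_cycle_add[OF \<open>0 < q\<close> this] show ?case by simp
qed

text \<open>The invariant that ties the recursion to multiples of \<open>q\<close>: the \<open>t\<close>-th cycle begins where the
  multiples of \<open>q\<close> reach \<open>t * n\<close> for the first time, and its minimal element is the overshoot.\<close>

lemma concat_q_cycles_prefix:
  assumes "0 < q" "q < n"
  shows "\<exists>c. concat (map (\<lambda>t. q_cycle q n (q_cycle_min q n t)) [0..<t])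
               = map (\<lambda>k. k * q mod n) [0..<c]
             \<and> q_cycle_min q n t + t * n = c * q"
proof (induction t)
  case 0
  then show ?case by (intro exI[of _ 0]) simp
next
  case (Suc t)
  then obtain c where
      prefix: "concat (map (\<lambda>t. q_cycle q n (q_cycle_min q n t)) [0..<t])
                 = map (\<lambda>k. k * q mod n) [0..<c]"
    and start: "q_cycle_min q n t + t * n = c * q"
    by blast
  let ?a = "q_cycle_min q n t"
  let ?C = "q_cycle q n ?a"
  have "?a < n" using q_cycle_min_less[OF assms, of t] assms by simp
  note C = less_length_q_cycle_iff[OF \<open>0 < q\<close> this] last_q_cycle_add[OF \<open>0 < q\<close> this]
  have cycle: "?C = map (\<lambda>k. k * q mod n) [c..<c + length ?C]"
  proof (rule nth_equalityI)
    fix l assume l: "l < length ?C"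
    have "(c + l) * q = (?a + l * q) + t * n"
      using start by (simp add: algebra_simps)
    then have "(c + l) * q mod n = ?a + l * q"
      using l C(1)[of l] by simp
    then show "?C ! l = map (\<lambda>k. k * q mod n) [c..<c + length ?C] ! l"
      using l by (simp add: nth_q_cycle)
  qed simp
  have "concat (map (\<lambda>t. q_cycle q n (q_cycle_min q n t)) [0..<Suc t])
          = map (\<lambda>k. k * q mod n) [0..<c] @ ?C"
    by (simp add: prefix)
  also have "\<dots> = map (\<lambda>k. k * q mod n) ([0..<c] @ [c..<c + length ?C])"
    using cycle by (metis map_append)
  also have "\<dots> = map (\<lambda>k. k * q mod n) [0..<c + length ?C]"
    using upt_add_eq_append[of 0 c "length ?C"] by simp
  finally have "concat (map (\<lambda>t. q_cycle q n (q_cycle_min q n t)) [0..<Suc t])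
                  = map (\<lambda>k. k * q mod n) [0..<c + length ?C]" .
  moreover have "q_cycle_min q n (Suc t) + Suc t * n = (c + length ?C) * q"
    using C(3,4) start by (simp add: algebra_simps)
  ultimately show ?case by blast
qed

text \<open>After \<open>q\<close> cycles the overshoot is both a multiple of \<open>q\<close> and less than \<open>q\<close>, so it vanishes:
  the list closes up, after exactly \<open>n\<close> entries.\<close>

lemma concat_q_cycle_list:
  assumes "0 < q" "q < n"
  shows "concat (q_cycle_list q n) = map (\<lambda>k. k * q mod n) [0..<n]"
    and "q_cycle_min q n q = 0"
proof -
  obtain c where c: "concat (q_cycle_list q n) = map (\<lambda>k. k * q mod n) [0..<c]"
      and eq: "q_cycle_min q n q + q * n = c * q"
    using concat_q_cycles_prefix[OF assms, of q] unfolding q_cycle_list_def by blast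
  have "q dvd q_cycle_min q n q"
    using eq by (metis dvd_add_left_iff dvd_triv_left dvd_triv_right)
  then show zero: "q_cycle_min q n q = 0"
    using q_cycle_min_less[OF assms, of q] by (auto dest: dvd_imp_le)
  from eq zero assms have "c = n" by simp
  with c show "concat (q_cycle_list q n) = map (\<lambda>k. k * q mod n) [0..<n]" by simp
qed

lemma q_cycle_entry_eq:
  assumes "0 < q" "q < n"
  shows "q_cycle_entry q n k = k * q mod n"
  using assms by (simp add: q_cycle_entry_def concat_q_cycle_list(1) mod_simps)

lemma q_cycle_entry_Suc:
  assumes "0 < q" "q < n"
  shows "q_cycle_entry q n (Suc k) = (q_cycle_entry q n k + q) mod n"
  using assms by (simp add: q_cycle_entry_eq mod_simps add.commute)

lemma q_cycle_entry_in_q_cycle: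
  assumes "0 < q" "q < n"
  obtains t l where "t < q" "l < length (q_cycle q n (q_cycle_min q n t))"
    "q_cycle_entry q n k = q_cycle_min q n t + l * q"
proof -
  have "q_cycle_entry q n k \<in> set (concat (q_cycle_list q n))"
    using assms unfolding q_cycle_entry_def Let_def
    by (intro nth_mem) (simp add: concat_q_cycle_list(1))
  then obtain t where "t < q" "q_cycle_entry q n k \<in> set (q_cycle q n (q_cycle_min q n t))"
    by (auto simp: q_cycle_list_def)
  then show thesis using that by (auto simp: in_set_conv_nth nth_q_cycle)
qed

lemma q_cycle_list_step:
  assumes "0 < q" "q < n"
  shows "follows_within_q_cycle q n e e' \<Longrightarrow> e + q < n"
    and "starts_next_q_cycle q n e e' \<Longrightarrow> n \<le> e + q"
proof -
  have min_less: "q_cycle_min q n t < n" for t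
    using q_cycle_min_less[OF assms, of t] assms by simp
  show "e + q < n" if "follows_within_q_cycle q n e e'"
  proof -
    from that obtain t l where l: "Suc l < length (q_cycle q n (q_cycle_min q n t))"
        and e: "q_cycle q n (q_cycle_min q n t) ! l = e"
      by (auto simp: follows_within_q_cycle_def q_cycle_list_def)
    have "e = q_cycle_min q n t + l * q"
      using l e by (simp add: nth_q_cycle)
    then show ?thesis
      using l less_length_q_cycle_iff[OF \<open>0 < q\<close> min_less, of "Suc l" t] by simp
  qed
  show "n \<le> e + q" if "starts_next_q_cycle q n e e'"
    using that last_q_cycle_add(3)[OF \<open>0 < q\<close> min_less]
    by (auto simp: starts_next_q_cycle_def q_cycle_list_def)
qed

text \<open>The residue \<open>e\<close> of \<open>k * q\<close> alone decides whether a step stays within its cycle, since a cycle is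
  continued as long as it stays below \<open>n\<close>.\<close>

lemma follows_within_q_cycle_entry_iff:
  assumes "0 < q" "q < n"
  shows "follows_within_q_cycle q n (q_cycle_entry q n k) (q_cycle_entry q n (Suc k))
           \<longleftrightarrow> q_cycle_entry q n k + q < n"
proof
  assume less: "q_cycle_entry q n k + q < n"
  obtain t l where tl: "t < q" "l < length (q_cycle q n (q_cycle_min q n t))"
      "q_cycle_entry q n k = q_cycle_min q n t + l * q"
    using q_cycle_entry_in_q_cycle[OF assms] by blast
  have "q_cycle_min q n t < n" using q_cycle_min_less[OF assms, of t] assms by simp
  then have "Suc l < length (q_cycle q n (q_cycle_min q n t))"
    using less tl(3) less_length_q_cycle_iff[OF \<open>0 < q\<close>, of _ n "Suc l"] by simp
  moreover have "q_cycle_entry q n (Suc k) = q_cycle_min q n t + Suc l * q"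
    using less tl(3) by (simp add: q_cycle_entry_Suc[OF assms])
  ultimately show "follows_within_q_cycle q n (q_cycle_entry q n k) (q_cycle_entry q n (Suc k))"
    unfolding follows_within_q_cycle_def
    using tl by (intro bexI[of _ "q_cycle q n (q_cycle_min q n t)"] exI[of _ l])
      (auto simp: nth_q_cycle q_cycle_list_def)
qed (rule q_cycle_list_step(1)[OF assms])

lemma starts_next_q_cycle_entry_iff:
  assumes "0 < q" "q < n"
  shows "starts_next_q_cycle q n (q_cycle_entry q n k) (q_cycle_entry q n (Suc k))
           \<longleftrightarrow> n \<le> q_cycle_entry q n k + q"
proof
  assume ge: "n \<le> q_cycle_entry q n k + q"
  obtain t l where tl: "t < q" "l < length (q_cycle q n (q_cycle_min q n t))"
      "q_cycle_entry q n k = q_cycle_min q n t + l * q"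
    using q_cycle_entry_in_q_cycle[OF assms] by blast
  have "q_cycle_min q n t < n" using q_cycle_min_less[OF assms, of t] assms by simp
  then have "\<not> Suc l < length (q_cycle q n (q_cycle_min q n t))"
    using ge tl(3) less_length_q_cycle_iff[OF \<open>0 < q\<close>, of _ n "Suc l"] by simp
  with tl(2) have "length (q_cycle q n (q_cycle_min q n t)) = Suc l" by simp
  then have last: "last (q_cycle q n (q_cycle_min q n t)) = q_cycle_entry q n k"
    using tl(3) by (simp add: last_q_cycle)
  have "q_cycle_entry q n k < n" using assms by (simp add: q_cycle_entry_eq)
  then have "q_cycle_entry q n (Suc k) = q_cycle_entry q n k + q - n"
    using ge assms by (simp add: q_cycle_entry_Suc[OF assms] le_mod_geq)
  then have next_min: "q_cycle_entry q n (Suc k) = q_cycle_min q n (Suc t)"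
    using last by simp
  \<comment> \<open>For \<open>t = q - 1\<close> the next cycle is the first one again.\<close>
  have "q_cycle_min q n (Suc t) = q_cycle_min q n (Suc t mod q)"
  proof (cases "Suc t = q")
    case True
    then show ?thesis using concat_q_cycle_list(2)[OF assms] by (metis mod_self q_cycle_min.simps(1))
  next
    case False
    with tl(1) show ?thesis by simp
  qed
  with last next_min tl(1) \<open>0 < q\<close>
  show "starts_next_q_cycle q n (q_cycle_entry q n k) (q_cycle_entry q n (Suc k))"
    unfolding starts_next_q_cycle_def
    by (intro exI[of _ t]) (simp add: q_cycle_list_def hd_q_cycle del: q_cycle_min.simps)
qed (rule q_cycle_list_step(2)[OF assms])

section \<open>The digits produced by the cycle rule\<close>

text \<open>The two step rules for edge labels are the two rules for \<open>q\<close>-cycles: a step between cycles is a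
  carry in the division by \<open>n\<close> and moves the edge by \<open>v\<^sub>1\<close>, any other step moves it by \<open>v\<^sub>2\<close>.\<close>

lemma edge_label_carry_step:
  assumes "q < n"
  shows "[edge_label m i j (int (Suc k * q div n)) (int (Suc k) - int (Suc k * q div n))
          = edge_label m i j (int (k * q div n)) (int k - int (k * q div n))
            + (if k * q mod n + q < n then i else j)] (mod m)"
proof -
  have "Suc k * q div n = k * q div n + (if k * q mod n + q < n then 0 else 1)"
  proof -
    have "Suc k * q = (k * q mod n + q) + (k * q div n) * n"
      by (simp add: div_mult_mod_eq algebra_simps)
    then have "Suc k * q div n = (k * q mod n + q) div n + k * q div n"
      using assms by (simp only: div_mult_self1)
    moreover have "(k * q mod n + q) div n = (if k * q mod n + q < n then 0 else 1)"
    proof (cases "k * q mod n + q < n")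
      case False
      moreover have "k * q mod n < n" using assms by simp
      ultimately have "k * q mod n + q - n < n" using assms by linarith
      then show ?thesis using False assms by (simp add: le_div_geq)
    qed simp
    ultimately show ?thesis by simp
  qed
  then show ?thesis
    using edge_label_step_v1[of m i j "int (k * q div n)" "int k - int (k * q div n)"]
      edge_label_step_v2[of m i j "int (k * q div n)" "int k - int (k * q div n)"]
    by (auto simp: algebra_simps)
qed

lemma constructed_from_q_cycles_iff_edge_label:
  assumes "0 < q" "q < n" and digits: "\<forall>k. d k \<in> {0..<m}"
  shows "constructed_from_q_cycles m i j q n d
    \<longleftrightarrow> (\<forall>k. d k = edge_label m i j (int (k * q div n)) (int k - int (k * q div n)))"
    (is "_ \<longleftrightarrow> (\<forall>k. d k = ?f k)")
proof -
  have digit_mod: "d k mod m = d k" for k using digits by simp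
  have rule: "constructed_from_q_cycles m i j q n d \<longleftrightarrow>
      d 0 = 0 \<and> (\<forall>k. [d (Suc k) = d k + (if k * q mod n + q < n then i else j)] (mod m))"
    unfolding constructed_from_q_cycles_def follows_within_q_cycle_entry_iff[OF assms(1,2)]
      starts_next_q_cycle_entry_iff[OF assms(1,2)]
    by (auto simp: q_cycle_entry_eq[OF assms(1,2)])
  have f_step: "[?f (Suc k) = ?f k + (if k * q mod n + q < n then i else j)] (mod m)" for k
    by (rule edge_label_carry_step[OF \<open>q < n\<close>])
  have f_0: "?f 0 = 0" by (simp add: edge_label_def)
  show ?thesis
  proof
    assume "constructed_from_q_cycles m i j q n d"
    then have d_0: "d 0 = 0"
      and d_step: "[d (Suc k) = d k + (if k * q mod n + q < n then i else j)] (mod m)" for k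
      using rule by blast+
    show "\<forall>k. d k = ?f k"
    proof
      fix k show "d k = ?f k"
      proof (induction k)
        case 0
        then show ?case using d_0 f_0 by simp
      next
        case (Suc k)
        have "[d (Suc k) = ?f (Suc k)] (mod m)"
          using d_step[of k] f_step[of k] unfolding Suc by (metis cong_sym cong_trans)
        then have "d (Suc k) mod m = ?f (Suc k) mod m" by (simp only: cong_def)
        then show ?case using digit_mod by (simp add: edge_label_def)
      qed
    qed
  next
    assume "\<forall>k. d k = ?f k"
    then show "constructed_from_q_cycles m i j q n d"
      using rule f_0 f_step by simp
  qed
qed

section \<open>The edges met by a ray\<close>

lemma independent_pair_coordinates:
  fixes v1 v2 :: "'a::real_vector"
  assumes "v1 \<noteq> v2" "independent {v1, v2}"
    and eq: "s *\<^sub>R v1 + t *\<^sub>R v2 = s' *\<^sub>R v1 + t' *\<^sub>R v2"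
  shows "s = s'" "t = t'"
proof -
  define u where "u v = (if v = v1 then s - s' else t - t')" for v
  have "(\<Sum>v\<in>{v1, v2}. u v *\<^sub>R v) = 0"
    using assms(1) eq by (simp add: u_def algebra_simps)
  then have "\<forall>v\<in>{v1, v2}. u v = 0"
    using assms(2) dependent_finite[of "{v1, v2}"] by auto
  then show "s = s'" "t = t'" using assms(1) by (auto simp: u_def)
qed

lemma ray_point_coordinates:
  assumes "0 < n"
  shows "ray_start v1 v2 a + t *\<^sub>R ray_direction v1 v2 q n
    = (a + t * real q / real n) *\<^sub>R v1 + (1 + t - (a + t * real q / real n)) *\<^sub>R v2"
proof -
  have "1 + t - (a + t * real q / real n) = 1 - a + t * ((real n - real q) / real n)"
    using assms by (simp add: field_simps)
  then show ?thesis
    by (simp only:) (simp add: ray_start_def ray_direction_def scaleR_add_left scaleR_add_right)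
qed

text \<open>A multiple of \<open>1/n\<close> is at least \<open>1/n\<close> below the next larger integer, so adding
  \<open>0 < a < 1/n\<close> leads strictly between two consecutive integers.\<close>

lemma shifted_multiple_between_integers:
  assumes "0 < n" "0 < a" "a < 1 / real n"
  shows "real (k * q div n) < a + real k * real q / real n"
    and "a + real k * real q / real n < real (k * q div n) + 1"
proof -
  have "real k * real q = real (k * q div n) * real n + real (k * q mod n)"
    by (metis div_mult_mod_eq of_nat_add of_nat_mult)
  then have eq: "real k * real q / real n = real (k * q div n) + real (k * q mod n) / real n"
    using assms by (simp add: field_simps)
  show "real (k * q div n) < a + real k * real q / real n"
    unfolding eq using assms by (simp add: add_pos_nonneg)
  have "k * q mod n + 1 \<le> n" using assms by (simp add: Suc_le_eq)
  then have "real (k * q mod n) + 1 \<le> real n" by linarith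
  then have "real (k * q mod n) / real n + 1 / real n \<le> 1"
    using assms by (simp add: field_simps)
  then show "a + real k * real q / real n < real (k * q div n) + 1"
    unfolding eq using assms by linarith
qed

lemma in_lattice_edge_iff:
  assumes "v1 \<noteq> v2" "independent {v1, v2}"
  shows "s *\<^sub>R v1 + t *\<^sub>R v2 \<in> lattice_edge v1 v2 x y
    \<longleftrightarrow> s + t = of_int (x + y + 1) \<and> of_int x \<le> s \<and> s \<le> of_int x + 1"
proof -
  have point: "(1 - u) *\<^sub>R (of_int x *\<^sub>R v1 + of_int (y + 1) *\<^sub>R v2)
        + u *\<^sub>R (of_int (x + 1) *\<^sub>R v1 + of_int y *\<^sub>R v2)
      = (of_int x + u) *\<^sub>R v1 + (of_int y + 1 - u) *\<^sub>R v2" for u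
    by (simp add: algebra_simps)
  have "s *\<^sub>R v1 + t *\<^sub>R v2 \<in> lattice_edge v1 v2 x y
      \<longleftrightarrow> (\<exists>u. s *\<^sub>R v1 + t *\<^sub>R v2 = (of_int x + u) *\<^sub>R v1 + (of_int y + 1 - u) *\<^sub>R v2
              \<and> 0 \<le> u \<and> u \<le> 1)"
    unfolding lattice_edge_def in_segment(1) point by blast
  also have "\<dots> \<longleftrightarrow> (\<exists>u. s = of_int x + u \<and> t = of_int y + 1 - u \<and> 0 \<le> u \<and> u \<le> 1)"
    using independent_pair_coordinates[OF assms] by metis
  also have "\<dots> \<longleftrightarrow> s + t = of_int (x + y + 1) \<and> of_int x \<le> s \<and> s \<le> of_int x + 1"
    by (auto intro: exI[of _ "s - of_int x"])
  finally show ?thesis .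
qed

text \<open>The coordinate sum \<open>k + 1\<close> gives \<open>y\<close> from \<open>x\<close>, and the first coordinate is strictly between two
  consecutive integers, which gives \<open>x\<close>.\<close>

lemma ray_point_on_lattice_edge_iff:
  assumes "v1 \<noteq> v2" "independent {v1, v2}" "0 < n" "0 < a" "a < 1 / real n"
  shows "ray_start v1 v2 a + real k *\<^sub>R ray_direction v1 v2 q n \<in> lattice_edge v1 v2 x y
    \<longleftrightarrow> x = int (k * q div n) \<and> y = int k - int (k * q div n)"
proof -
  let ?s = "a + real k * real q / real n"
  note bounds = shifted_multiple_between_integers[OF assms(3-5), of k q]
  have "(real_of_int x \<le> ?s \<and> ?s \<le> real_of_int x + 1) \<longleftrightarrow> x = int (k * q div n)"
  proof
    assume "real_of_int x \<le> ?s \<and> ?s \<le> real_of_int x + 1"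
    with bounds have "real_of_int x < real_of_int (int (k * q div n) + 1)"
      "real_of_int (int (k * q div n)) < real_of_int (x + 1)" by auto
    then show "x = int (k * q div n)" unfolding of_int_less_iff by linarith
  next
    assume "x = int (k * q div n)"
    with bounds show "real_of_int x \<le> ?s \<and> ?s \<le> real_of_int x + 1" by simp
  qed
  moreover have "?s + (1 + real k - ?s) = of_int (x + y + 1) \<longleftrightarrow> int k = x + y"
  proof -
    have "?s + (1 + real k - ?s) = of_int (int k + 1)" by simp
    then show ?thesis by (metis add_right_cancel of_int_eq_iff)
  qed
  ultimately show ?thesis
    unfolding ray_point_coordinates[OF \<open>0 < n\<close>] in_lattice_edge_iff[OF assms(1,2)] by auto
qed

lemma is_digit_string_iff_edge_label:
  assumes "v1 \<noteq> v2" "independent {v1, v2}" "0 < n" "0 < a" "a < 1 / real n"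
  shows "is_digit_string v1 v2 m i j (ray_start v1 v2 a) (ray_direction v1 v2 q n) d
    \<longleftrightarrow> (\<forall>k. d k = edge_label m i j (int (k * q div n)) (int k - int (k * q div n)))"
  unfolding is_digit_string_def ray_point_on_lattice_edge_iff[OF assms] by auto

text \<open>The coordinates of a vertex have an integer sum, so the ray could only meet a vertex at an integer
  time \<open>k\<close>; but then its first coordinate is not an integer.\<close>

lemma nonsingular_ray:
  assumes "v1 \<noteq> v2" "independent {v1, v2}" "0 < n" "0 < a" "a < 1 / real n"
  shows "nonsingular v1 v2 (ray (ray_start v1 v2 a) (ray_direction v1 v2 q n))"
proof -
  have False if "0 \<le> t"
    and eq: "ray_start v1 v2 a + t *\<^sub>R ray_direction v1 v2 q n = of_int x *\<^sub>R v1 + of_int y *\<^sub>R v2"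
    for t x y
  proof -
    note coords = independent_pair_coordinates[OF assms(1,2)
        eq[unfolded ray_point_coordinates[OF \<open>0 < n\<close>]]]
    from coords have "t = of_int (x + y - 1)" by simp
    with \<open>0 \<le> t\<close> have t: "t = real (nat (x + y - 1))" by simp
    with coords(1) shifted_multiple_between_integers[OF assms(3-5), of "nat (x + y - 1)" q]
    have "real_of_int (int (nat (x + y - 1) * q div n)) < real_of_int x"
      "real_of_int x < real_of_int (int (nat (x + y - 1) * q div n) + 1)" by simp_all
    then show False unfolding of_int_less_iff by linarith
  qed
  then show ?thesis
    unfolding nonsingular_def ray_def vertex_lattice_def by blast
qed

section \<open>Rays and \<open>q\<close>-cycles give the same digit strings\<close>

theorem theorem3p5:
  fixes m i j :: int and v1 v2 :: "real ^ 2" and d :: "nat \<Rightarrow> int"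
  assumes "(m, i, j) \<in> digit_rule_data"
    and "v1 \<noteq> v2" and "independent {v1, v2}"
    and "\<forall>k. d k \<in> {0..<m}"
    and "\<exists>p>0. \<forall>k. d (k + p) = d k"
  shows "nonsingular_billiard_sequence v1 v2 m i j d \<longleftrightarrow>
    (\<exists>(q::nat) (n::nat). 0 < q \<and> q < n \<and> coprime q n \<and> constructed_from_q_cycles m i j q n d)"
proof
  assume "nonsingular_billiard_sequence v1 v2 m i j d"
  then obtain q n a where qn: "0 < q" "q < n" "coprime q n" and a: "0 < a" "a < 1 / real n"
      and "is_digit_string v1 v2 m i j (ray_start v1 v2 a) (ray_direction v1 v2 q n) d"
    unfolding nonsingular_billiard_sequence_def by blast
  moreover have "0 < n" using qn by simp
  ultimately have "constructed_from_q_cycles m i j q n d"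
    by (simp add: is_digit_string_iff_edge_label[OF assms(2,3)]
        constructed_from_q_cycles_iff_edge_label[OF _ _ assms(4)])
  with qn show "\<exists>q n. 0 < q \<and> q < n \<and> coprime q n \<and> constructed_from_q_cycles m i j q n d"
    by blast
next
  assume "\<exists>q n. 0 < q \<and> q < n \<and> coprime q n \<and> constructed_from_q_cycles m i j q n d"
  then obtain q n where qn: "0 < q" "q < n" "coprime q n"
      and constructed: "constructed_from_q_cycles m i j q n d" by blast
  have "0 < n" using qn by simp
  \<comment> \<open>Any starting point with \<open>0 < a < 1 / n\<close> gives the same digits.\<close>
  define a where "a = 1 / (2 * real n)"
  have a: "0 < a" "a < 1 / real n" using \<open>0 < n\<close> by (simp_all add: a_def field_simps)
  have "is_digit_string v1 v2 m i j (ray_start v1 v2 a) (ray_direction v1 v2 q n) d"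
    using constructed
    unfolding is_digit_string_iff_edge_label[OF assms(2,3) \<open>0 < n\<close> a]
      constructed_from_q_cycles_iff_edge_label[OF qn(1,2) assms(4)] .
  with qn a nonsingular_ray[OF assms(2,3) \<open>0 < n\<close> a]
  show "nonsingular_billiard_sequence v1 v2 m i j d"
    unfolding nonsingular_billiard_sequence_def by blast
qed

end
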